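(* Let $\{(x^k,\bar x^k,\lambda^k)\}_{k\ge 1}$ be a sequence generated by the accelerated linearized augmented Lagrangian method (described in the context) for the problem $\min_x f(x)+g(x)$ subject to $Ax=b$, with parameters set, for all $k\ge 1$, to $$\alpha_k=\frac{2}{k+1},\quad \gamma_k=k\gamma,\quad \beta_k\ge \frac{\gamma_k}{2},\quad P^k=\frac{\eta}{k} I,$$ where $\gamma>0$ and $\eta\ge 2L_f$. Let $(x^*,\lambda^* )$ be any point satisfying the KKT conditions $0\in\partial F(x^* )-A^\top\lambda^*$ and $Ax^*-b=0$. Then for every $t\ge 1$, $$|F(\bar x^{t+1})-F(x^* )|\le \frac{1}{t(t+1)}\left(\eta\|x^1-x^*\|^2+\frac{4\|\lambda^*\|^2}{\gamma}\right),$$ and, if $\lambda^*\ne 0$, $$\|A\bar x^{t+1}-b\|\le \frac{1}{t(t+1)\|\lambda^*\|}\left(\eta\|x^1-x^*\|^2+\frac{4\|\lambda^*\|^2}{\gamma}\right).$$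
   Context: Setting: $x\in\mathbb{R}^n$, $A\in\mathbb{R}^{m\times n}$, $b\in\mathbb{R}^m$, norms are Euclidean. $F=f+g$, where $f:\mathbb{R}^n\to\mathbb{R}$ is convex and differentiable and $g:\mathbb{R}^n\to\mathbb{R}\cup\{+\infty\}$ is proper closed convex, possibly nondifferentiable. For a vector $v$ and symmetric matrix $W$, $\|v\|_W^2=v^\top Wv$. Standing assumptions: (1) there exists a point $(x^*,\lambda^* )$ satisfying the KKT conditions $0\in\partial F(x^* )-A^\top\lambda^*$, $Ax^*=b$; (2) $\nabla f$ is Lipschitz continuous with constant $L_f$: $\|\nabla f(x)-\nabla f(\tilde x)\|\le L_f\|x-\tilde x\|$ for all $x,\tilde x$. Accelerated linearized augmented Lagrangian method: choose $\bar x^1=x^1\in\mathbb{R}^n$ and set $\lambda^1=0$. For $k=1,2,\ldots$, with parameters $\alpha_k,\beta_k,\gamma_k$ and $P^k$ (a symmetric matrix), perform $$\hat x^k=(1-\alpha_k)\bar x^k+\alpha_k x^k,$$ $$x^{k+1}\in\operatorname{argmin}_x\ \langle\nabla f(\hat x^k)-A^\top\lambda^k,x\rangle+g(x)+\frac{\beta_k}{2}\|Ax-b\|^2+\frac12\|x-x^k\|_{P^k}^2,$$ $$\bar x^{k+1}=(1-\alpha_k)\bar x^k+\alpha_k x^{k+1},$$ $$\lambda^{k+1}=\lambda^k-\gamma_k(Ax^{k+1}-b).$$ It is assumed that the iterates exist (each argmin is nonempty). *)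

theory Defs
  imports "HOL-Analysis.Analysis"
begin

text \<open>Functions with values in \<open>\<real> \<union> {+\<infinity>}\<close> are modelled as \<^typ>\<open>ereal\<close>-valued
  functions; \<open>-\<infinity>\<close> is excluded by properness. The library's \<open>epigraph\<close> covers only
  real-valued functions.\<close>

definition ereal_epigraph :: "('a \<Rightarrow> ereal) \<Rightarrow> ('a \<times> real) set" where
  "ereal_epigraph g = {(x, r). g x \<le> ereal r}"

definition proper_closed_convex :: "('a::euclidean_space \<Rightarrow> ereal) \<Rightarrow> bool" where
  "proper_closed_convex g \<longleftrightarrow>
     (\<forall>x. g x \<noteq> -\<infinity>) \<and> (\<exists>x. g x \<noteq> \<infinity>) \<and>
     closed (ereal_epigraph g) \<and> convex (ereal_epigraph g)"

text \<open>Convention: the subdifferential is empty outside the effective domain.\<close>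

definition subdifferential :: "('a::real_inner \<Rightarrow> ereal) \<Rightarrow> 'a \<Rightarrow> 'a set" where
  "subdifferential F x =
     {v. \<bar>F x\<bar> \<noteq> \<infinity> \<and> (\<forall>y. F x + ereal (v \<bullet> (y - x)) \<le> F y)}"

definition KKT_point ::
  "((real^'n) \<Rightarrow> ereal) \<Rightarrow> real^'n^'m \<Rightarrow> real^'m \<Rightarrow> real^'n \<Rightarrow> real^'m \<Rightarrow> bool" where
  "KKT_point F A b x l \<longleftrightarrow>
     0 \<in> (\<lambda>v. v - transpose A *v l) ` subdifferential F x \<and> A *v x - b = 0"

text \<open>\<open>\<parallel>v\<parallel>\<^sub>W\<^sup>2 = v\<^sup>T W v\<close>\<close>

definition wnorm_sq :: "real^'n^'n \<Rightarrow> real^'n \<Rightarrow> real" where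
  "wnorm_sq W v = v \<bullet> (W *v v)"

text \<open>The objective minimised in the primal update, with linearisation point \<open>xh\<close>,
  multiplier \<open>l\<close> and proximal centre \<open>xk\<close>; \<open>df\<close> is the gradient of the smooth part.\<close>

definition subproblem ::
  "((real^'n) \<Rightarrow> real^'n) \<Rightarrow> ((real^'n) \<Rightarrow> ereal) \<Rightarrow> real^'n^'m \<Rightarrow> real^'m
    \<Rightarrow> real \<Rightarrow> real^'n^'n \<Rightarrow> real^'n \<Rightarrow> real^'m \<Rightarrow> real^'n \<Rightarrow> real^'n \<Rightarrow> ereal" where
  "subproblem df g A b \<beta> P xh l xk x =
     ereal ((df xh - transpose A *v l) \<bullet> x) + g x
       + ereal (\<beta> / 2 * (norm (A *v x - b))\<^sup>2 + 1 / 2 * wnorm_sq P (x - xk))"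

text \<open>All sequences are indexed from 1; their values at 0 are irrelevant.\<close>

definition accelerated_linearized_ALM ::
  "((real^'n) \<Rightarrow> real^'n) \<Rightarrow> ((real^'n) \<Rightarrow> ereal) \<Rightarrow> real^'n^'m \<Rightarrow> real^'m
    \<Rightarrow> (nat \<Rightarrow> real) \<Rightarrow> (nat \<Rightarrow> real) \<Rightarrow> (nat \<Rightarrow> real) \<Rightarrow> (nat \<Rightarrow> real^'n^'n)
    \<Rightarrow> (nat \<Rightarrow> real^'n) \<Rightarrow> (nat \<Rightarrow> real^'n) \<Rightarrow> (nat \<Rightarrow> real^'m) \<Rightarrow> bool" where
  "accelerated_linearized_ALM df g A b \<alpha> \<beta> \<gamma> P x xbar l \<longleftrightarrow>
     xbar 1 = x 1 \<and> l 1 = 0 \<and>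
     (\<forall>k\<ge>1. transpose (P k) = P k \<and>
        (let xh = (1 - \<alpha> k) *\<^sub>R xbar k + \<alpha> k *\<^sub>R x k in
           is_arg_min (subproblem df g A b (\<beta> k) (P k) xh (l k) (x k)) (\<lambda>_. True) (x (k + 1))) \<and>
        xbar (k + 1) = (1 - \<alpha> k) *\<^sub>R xbar k + \<alpha> k *\<^sub>R x (k + 1) \<and>
        l (k + 1) = l k - \<gamma> k *\<^sub>R (A *v x (k + 1) - b))"

end

theory Submission imports Defs begin

text \<open>
  For a multiplier \<open>v\<close> let \<open>\<Phi> v y = F y - F x\<^sup>* - \<langle>v, A y - b\<rangle>\<close>. Convexity, the descent lemma and the
  optimality condition of the primal update bound \<open>\<Phi> v\<close> at the new average by \<open>1 - \<alpha>\<^sub>k\<close> times its old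
  value plus \<open>\<alpha>\<^sub>k\<close> times a difference of squared primal and dual distances. Multiplied by \<open>k (k + 1)\<close>
  this telescopes: \<open>k (k - 1) \<Phi> v (xbar\<^sub>k) + \<eta> \<parallel>x\<^sub>k - x\<^sup>*\<parallel>\<^sup>2 + \<parallel>\<lambda>\<^sub>k - v\<parallel>\<^sup>2 / \<gamma>\<close> is nonincreasing in \<open>k\<close>.
  Taking \<open>v\<close> of norm \<open>2 \<parallel>\<lambda>\<^sup>*\<parallel>\<close> opposite to the residual bounds
  \<open>F - F x\<^sup>* + 2 \<parallel>\<lambda>\<^sup>*\<parallel> \<parallel>A y - b\<parallel>\<close> from above, while the KKT condition gives
  \<open>F - F x\<^sup>* \<ge> - \<parallel>\<lambda>\<^sup>*\<parallel> \<parallel>A y - b\<parallel>\<close>.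
\<close>

section \<open>Tangent and descent inequalities for the smooth part\<close>

lemma has_real_derivative_along_line:
  fixes f :: "'a::real_inner \<Rightarrow> real"
  assumes "GDERIV f (z + s *\<^sub>R d) :> D"
  shows "((\<lambda>s. f (z + s *\<^sub>R d)) has_real_derivative D \<bullet> d) (at s)"
proof -
  have "((\<lambda>s. z + s *\<^sub>R d) has_derivative (\<lambda>h. h *\<^sub>R d)) (at s)"
    by (auto intro!: derivative_eq_intros)
  moreover have "(f has_derivative (\<lambda>h. h \<bullet> D)) (at (z + s *\<^sub>R d))"
    using assms by (simp add: gderiv_def)
  ultimately have "((\<lambda>s. f (z + s *\<^sub>R d)) has_derivative (\<lambda>h. (h *\<^sub>R d) \<bullet> D)) (at s)"
    by (rule has_derivative_compose)
  moreover have "(\<lambda>h. (h *\<^sub>R d) \<bullet> D) = (*) (D \<bullet> d)"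
    by (auto simp: inner_commute mult.commute)
  ultimately show ?thesis
    by (simp add: has_field_derivative_def)
qed

text \<open>Restriction to the line through \<open>z\<close> and \<open>y\<close> reduces this to
  the tangent inequality for convex functions of one real variable, taken at parameter 0.\<close>

lemma convex_on_gderiv_le:
  fixes f :: "'a::real_inner \<Rightarrow> real"
  assumes "convex_on UNIV f" "GDERIV f z :> D"
  shows "f z + D \<bullet> (y - z) \<le> f y"
proof -
  let ?h = "\<lambda>s. f (z + s *\<^sub>R (y - z))"
  have "convex_on UNIV ?h"
  proof (rule convex_onI)
    fix u r s :: real
    assume "0 < u" "u < 1"
    moreover have "z + ((1 - u) *\<^sub>R r + u *\<^sub>R s) *\<^sub>R (y - z)
        = (1 - u) *\<^sub>R (z + r *\<^sub>R (y - z)) + u *\<^sub>R (z + s *\<^sub>R (y - z))"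
      by (simp add: algebra_simps)
    ultimately show "?h ((1 - u) *\<^sub>R r + u *\<^sub>R s) \<le> (1 - u) * ?h r + u * ?h s"
      using convex_onD[OF assms(1), of u "z + r *\<^sub>R (y - z)" "z + s *\<^sub>R (y - z)"] by simp
  qed simp
  then have "D \<bullet> (y - z) * (1 - 0) \<le> ?h 1 - ?h 0"
    using assms(2)
    by (intro convex_on_imp_above_tangent[where A = UNIV]
        has_real_derivative_along_line[of f z 0, simplified]) auto
  then show ?thesis by simp
qed

text \<open>Descent lemma. Along the segment, \<open>f\<close> minus its linear part and the
  quadratic term has nonpositive derivative, by Cauchy-Schwarz and the Lipschitz bound; comparing
  the endpoints gives the claim.\<close>

lemma lipschitz_gradient_upper_bound:
  fixes f :: "'a::real_inner \<Rightarrow> real"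
  assumes deriv: "\<And>z. GDERIV f z :> df z"
    and lip: "\<And>y z. norm (df y - df z) \<le> L * norm (y - z)"
  shows "f y \<le> f z + df z \<bullet> (y - z) + L / 2 * (norm (y - z))\<^sup>2"
proof -
  define d where "d = y - z"
  let ?h = "\<lambda>s. f (z + s *\<^sub>R d) - s * (df z \<bullet> d) - L / 2 * s\<^sup>2 * (norm d)\<^sup>2"
  let ?h' = "\<lambda>s. (df (z + s *\<^sub>R d) - df z) \<bullet> d - L * s * (norm d)\<^sup>2"
  have der: "(?h has_real_derivative ?h' s) (at s)" for s
    by (auto intro!: derivative_eq_intros has_real_derivative_along_line deriv
        simp: inner_diff_left)
  have nonpos: "?h' s \<le> 0" if "0 \<le> s" for s
  proof -
    have "(df (z + s *\<^sub>R d) - df z) \<bullet> d \<le> norm (df (z + s *\<^sub>R d) - df z) * norm d"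
      by (rule norm_cauchy_schwarz)
    also have "\<dots> \<le> (L * norm (s *\<^sub>R d)) * norm d"
      using lip[of "z + s *\<^sub>R d" z] by (intro mult_right_mono) auto
    finally show ?thesis using that by (simp add: power2_eq_square)
  qed
  have "?h 1 \<le> ?h 0"
  proof (rule DERIV_nonpos_imp_nonincreasing[of 0 1 ?h])
    fix s :: real
    assume "0 \<le> s"
    show "\<exists>D. (?h has_real_derivative D) (at s) \<and> D \<le> 0"
      using der[of s] nonpos[OF \<open>0 \<le> s\<close>] by (intro exI conjI)
  qed simp
  then show ?thesis by (simp add: d_def)
qed

section \<open>The extended-valued part as a real convex function on its domain\<close>

lemma proper_closed_convex_ereal_real:
  assumes "proper_closed_convex g" "g z \<noteq> \<infinity>"
  shows "ereal (real_of_ereal (g z)) = g z"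
  using assms by (intro ereal_real' ereal_infinity_cases) (simp_all add: proper_closed_convex_def)

text \<open>Moves all later estimates into real arithmetic. A convex combination of the points
  \<open>(y, ?G y)\<close> and \<open>(z, ?G z)\<close> stays in the epigraph, which yields both
  convexity of the domain and the inequality.\<close>

lemma proper_closed_convex_convex_on:
  assumes "proper_closed_convex g"
  shows "convex_on {z. g z \<noteq> \<infinity>} (\<lambda>z. real_of_ereal (g z))"
proof -
  let ?D = "{z. g z \<noteq> \<infinity>}" and ?G = "\<lambda>z. real_of_ereal (g z)"
  have fin: "ereal (?G z) = g z" if "z \<in> ?D" for z
    using that proper_closed_convex_ereal_real[OF assms] by simp
  have comb: "g (u *\<^sub>R y + v *\<^sub>R z) \<le> ereal (u * ?G y + v * ?G z)"
    if "y \<in> ?D" "z \<in> ?D" "0 \<le> u" "0 \<le> v" "u + v = 1" for y z u v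
  proof -
    have "convex (ereal_epigraph g)"
      using assms by (simp add: proper_closed_convex_def)
    moreover have "(y, ?G y) \<in> ereal_epigraph g" "(z, ?G z) \<in> ereal_epigraph g"
      using fin that by (simp_all add: ereal_epigraph_def)
    ultimately have "u *\<^sub>R (y, ?G y) + v *\<^sub>R (z, ?G z) \<in> ereal_epigraph g"
      using that by (intro convexD)
    then show ?thesis by (simp add: ereal_epigraph_def)
  qed
  have conv: "convex ?D"
  proof (rule convexI)
    fix y z and u v :: real
    assume "y \<in> ?D" "z \<in> ?D" "0 \<le> u" "0 \<le> v" "u + v = 1"
    from comb[OF this] show "u *\<^sub>R y + v *\<^sub>R z \<in> ?D" by auto
  qed
  show ?thesis
    unfolding convex_on_def
  proof (intro conjI ballI allI impI)
    fix y z and u v :: real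
    assume h: "y \<in> ?D" "z \<in> ?D" "0 \<le> u" "0 \<le> v" "u + v = 1"
    then have "ereal (?G (u *\<^sub>R y + v *\<^sub>R z)) = g (u *\<^sub>R y + v *\<^sub>R z)"
      by (intro fin convexD[OF conv])
    with comb[OF h] have "ereal (?G (u *\<^sub>R y + v *\<^sub>R z)) \<le> ereal (u * ?G y + v * ?G z)"
      by simp
    then show "?G (u *\<^sub>R y + v *\<^sub>R z) \<le> u * ?G y + v * ?G z"
      by (simp only: ereal_less_eq)
  qed (rule conv)
qed

section \<open>Optimality condition of the primal update\<close>

lemma le_if_le_plus_small_multiple:
  fixes p q C :: real
  assumes "\<And>s. 0 < s \<Longrightarrow> s \<le> 1 \<Longrightarrow> p \<le> q + s * C"
  shows "p \<le> q"
proof (rule tendsto_lowerbound)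
  show "((\<lambda>s. q + s * C) \<longlongrightarrow> q) (at_right 0)"
    by (auto intro!: tendsto_eq_intros)
  show "\<forall>\<^sub>F s in at_right 0. p \<le> q + s * C"
    using assms by (auto simp: eventually_at_right_field intro!: exI[of _ 1])
qed simp

text \<open>The minimizer is compared with the point a fraction \<open>s\<close> of the way to
  \<open>z\<close>. Convexity bounds \<open>G\<close>, the quadratics expand exactly, and division
  by \<open>s\<close> leaves an error \<open>s * ?C\<close> that vanishes as \<open>s\<close> tends
  to 0. This takes the place of a sum rule for subdifferentials.\<close>

lemma composite_minimizer_variational_inequality:
  fixes G :: "real^'n \<Rightarrow> real" and A :: "real^'n^'m" and b :: "real^'m"
  assumes G: "convex_on D G" and xp: "xp \<in> D" and z: "z \<in> D"
    and min: "\<And>y. y \<in> D \<Longrightarrow>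
      c \<bullet> xp + G xp + \<beta> / 2 * (norm (A *v xp - b))\<^sup>2 + p / 2 * (norm (xp - x0))\<^sup>2
      \<le> c \<bullet> y + G y + \<beta> / 2 * (norm (A *v y - b))\<^sup>2 + p / 2 * (norm (y - x0))\<^sup>2"
  shows "G xp + c \<bullet> (xp - z) + \<beta> * ((A *v xp - b) \<bullet> (A *v (xp - z)))
    + p * ((xp - x0) \<bullet> (xp - z)) \<le> G z"
proof -
  define d where "d = z - xp"
  have line: "A *v (xp + s *\<^sub>R d) - b = (A *v xp - b) + s *\<^sub>R (A *v d)"
    "(xp + s *\<^sub>R d) - x0 = (xp - x0) + s *\<^sub>R d" for s
    by (auto simp: matrix_vector_right_distrib matrix_vector_mult_scaleR)
  have sq: "(norm (u + s *\<^sub>R v))\<^sup>2 = (norm u)\<^sup>2 + 2 * s * (u \<bullet> v) + s\<^sup>2 * (norm v)\<^sup>2"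
    for u v :: "'k::real_inner" and s :: real
    unfolding power2_norm_eq_inner
    by (simp add: inner_simps inner_commute power2_eq_square)
  let ?C = "\<beta> / 2 * (norm (A *v d))\<^sup>2 + p / 2 * (norm d)\<^sup>2"
  have "G xp \<le> G z + c \<bullet> d + \<beta> * ((A *v xp - b) \<bullet> (A *v d)) + p * ((xp - x0) \<bullet> d)"
  proof (rule le_if_le_plus_small_multiple)
    fix s :: real assume s: "0 < s" "s \<le> 1"
    have eq: "xp + s *\<^sub>R d = (1 - s) *\<^sub>R xp + s *\<^sub>R z"
      by (simp add: d_def algebra_simps)
    have "xp + s *\<^sub>R d \<in> D"
      unfolding eq using convex_on_imp_convex[OF G] xp z s by (intro convexD) auto
    moreover have "G (xp + s *\<^sub>R d) \<le> (1 - s) * G xp + s * G z"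
      unfolding eq using convex_onD[OF G] xp z s by simp
    ultimately have "s * G xp \<le> s * G z + s * (c \<bullet> d)
        + \<beta> / 2 * (2 * s * ((A *v xp - b) \<bullet> (A *v d)) + s\<^sup>2 * (norm (A *v d))\<^sup>2)
        + p / 2 * (2 * s * ((xp - x0) \<bullet> d) + s\<^sup>2 * (norm d)\<^sup>2)"
      using min[of "xp + s *\<^sub>R d"] unfolding line sq by (simp add: inner_add_right algebra_simps)
    also have "\<dots> = s * (G z + c \<bullet> d + \<beta> * ((A *v xp - b) \<bullet> (A *v d)) + p * ((xp - x0) \<bullet> d) + s * ?C)"
      by (simp add: field_simps power2_eq_square)
    finally show "G xp \<le> G z + c \<bullet> d + \<beta> * ((A *v xp - b) \<bullet> (A *v d)) + p * ((xp - x0) \<bullet> d) + s * ?C"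
      using s by simp
  qed
  moreover have "A *v d = - (A *v (xp - z))" "w \<bullet> d = - (w \<bullet> (xp - z))" for w
    by (simp_all add: d_def matrix_vector_mult_diff_distrib inner_diff_right)
  ultimately show ?thesis by simp
qed

section \<open>Distance estimates for the primal and dual steps\<close>

lemma two_inner_eq_norm_sq:
  "2 * ((p - q) \<bullet> (p - z)) = (norm (p - z))\<^sup>2 - (norm (q - z))\<^sup>2 + (norm (p - q))\<^sup>2"
  for p q z :: "'a::real_inner"
  by (simp add: power2_norm_eq_inner inner_simps inner_commute)

text \<open>Expanding the square leaves a surplus \<open>c\<^sup>2 * (norm r)\<^sup>2\<close>; the
  condition on \<beta> is what lets the penalty term absorb it.\<close>

lemma dual_step_bound:
  fixes u u' v r :: "'a::real_inner"
  assumes u': "u' = u - c *\<^sub>R r" and c: "c > 0" and \<beta>: "\<beta> \<ge> c / 2"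
  shows "2 * c * ((u - v) \<bullet> r - \<beta> * (norm r)\<^sup>2) \<le> (norm (u - v))\<^sup>2 - (norm (u' - v))\<^sup>2"
proof -
  have "(norm (u - v))\<^sup>2 - (norm (u' - v))\<^sup>2 = 2 * c * ((u - v) \<bullet> r) - c\<^sup>2 * (norm r)\<^sup>2"
    unfolding u' power2_norm_eq_inner
    by (simp add: inner_simps inner_commute power2_eq_square algebra_simps)
  moreover have "c\<^sup>2 * (norm r)\<^sup>2 \<le> 2 * c * \<beta> * (norm r)\<^sup>2"
    using c \<beta> by (intro mult_right_mono) (auto simp: power2_eq_square)
  ultimately show ?thesis by (simp add: algebra_simps)
qed

text \<open>The radius is twice \<open>norm ls\<close> so that, after the lower bound has used up
  one multiple of \<open>norm ls * norm r\<close>, another remains to bound the residual.\<close>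

lemma gap_and_residual_bounds:
  fixes r ls :: "'a::real_inner"
  assumes upper: "\<And>v. norm v = 2 * norm ls \<Longrightarrow> gap - v \<bullet> r \<le> B"
    and lower: "ls \<bullet> r \<le> gap"
  shows "\<bar>gap\<bar> \<le> B" "norm ls * norm r \<le> B"
proof -
  have "gap + 2 * norm ls * norm r \<le> B"
  proof (cases "r = 0")
    case True
    then show ?thesis using upper[of "2 *\<^sub>R ls"] by simp
  next
    case False
    then show ?thesis
      \<comment> \<open>This vector has the required norm and points against \<open>r\<close>, so
        \<open>- v \<bullet> r\<close> equals \<open>2 * norm ls * norm r\<close>.\<close>
      using upper[of "- (2 * norm ls / norm r) *\<^sub>R r"]
      by (simp add: dot_square_norm power2_eq_square)
  qed
  moreover have "- (norm ls * norm r) \<le> gap"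
    using lower norm_cauchy_schwarz[of "- ls" r] by simp
  moreover have "0 \<le> norm ls * norm r" by simp
  ultimately show "\<bar>gap\<bar> \<le> B" "norm ls * norm r \<le> B" by linarith+
qed

text \<open>The alternative \<open>a = 1\<close> covers the first iteration, whose starting point need not lie in the
  domain of \<open>g\<close>: there \<open>G xb\<close> is a junk value, which the factor \<open>1 - a = 0\<close> removes.\<close>

lemma lagrangian_gap_step:
  fixes f G :: "real^'n \<Rightarrow> real" and A :: "real^'n^'m" and b l v :: "real^'m"
  defines "\<Phi> \<equiv> \<lambda>y z. f y + G y - (f z + G z) - v \<bullet> (A *v y - b)"
  assumes f: "convex_on UNIV f" "\<And>z. GDERIV f z :> df z"
    and lip: "\<And>y z. norm (df y - df z) \<le> L * norm (y - z)"
    and G: "convex_on D G" and z: "z \<in> D" "A *v z = b"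
    and xp: "xp \<in> D" and xb: "xb \<in> D \<or> a = 1"
    and xh: "xh = (1 - a) *\<^sub>R xb + a *\<^sub>R x"
    and min: "\<And>y. y \<in> D \<Longrightarrow>
      (df xh - transpose A *v l) \<bullet> xp + G xp + \<beta> / 2 * (norm (A *v xp - b))\<^sup>2 + p / 2 * (norm (xp - x))\<^sup>2
      \<le> (df xh - transpose A *v l) \<bullet> y + G y + \<beta> / 2 * (norm (A *v y - b))\<^sup>2 + p / 2 * (norm (y - x))\<^sup>2"
    and a: "0 < a" "a \<le> 1" and c: "c > 0" and \<beta>: "\<beta> \<ge> c / 2" and p: "L * a \<le> p"
    and xbp: "xbp = (1 - a) *\<^sub>R xb + a *\<^sub>R xp"
    and lp: "lp = l - c *\<^sub>R (A *v xp - b)"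
  shows "xbp \<in> D"
    and "\<Phi> xbp z \<le> (1 - a) * \<Phi> xb z
      + a * (((norm (l - v))\<^sup>2 - (norm (lp - v))\<^sup>2) / (2 * c)
             + p / 2 * ((norm (x - z))\<^sup>2 - (norm (xp - z))\<^sup>2))"
proof -
  let ?r = "A *v xp - b"
  show "xbp \<in> D"
    using xb xp a convexD[OF convex_on_imp_convex[OF G], of xb xp "1 - a" a] by (auto simp: xbp)
  have G_le: "G xbp \<le> (1 - a) * G xb + a * G xp"
    using xb xp a convex_onD[OF G, of a xb xp] by (auto simp: xbp)

  \<comment> \<open>The average moves by only \<open>a\<close> times the primal step, so the descent
    lemma costs a factor \<open>a * a\<close>; this is why \<open>L * a \<le> p\<close>
    suffices.\<close>
  have "xbp - xh = a *\<^sub>R (xp - x)"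
    by (simp add: xbp xh algebra_simps)
  then have sq: "(norm (xbp - xh))\<^sup>2 = a * a * (norm (xp - x))\<^sup>2"
    by (simp add: power_mult_distrib power2_eq_square)
  \<comment> \<open>Writing \<open>xp\<close> as \<open>z + (xp - z)\<close> prepares tangent
    inequalities at \<open>xb\<close> and \<open>z\<close>; the last term is left to the optimality
    condition.\<close>
  have split: "df xh \<bullet> (xbp - xh) = (1 - a) * (df xh \<bullet> (xb - xh)) + a * (df xh \<bullet> (z - xh)) + a * (df xh \<bullet> (xp - z))"
    by (simp add: xbp inner_simps algebra_simps)
  have "f xbp \<le> f xh + df xh \<bullet> (xbp - xh) + L / 2 * (norm (xbp - xh))\<^sup>2"
    by (rule lipschitz_gradient_upper_bound[OF f(2) lip])
  also have "\<dots> = (1 - a) * (f xh + df xh \<bullet> (xb - xh)) + a * (f xh + df xh \<bullet> (z - xh))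
      + a * (df xh \<bullet> (xp - z)) + a / 2 * (L * a) * (norm (xp - x))\<^sup>2"
    unfolding split sq by (simp add: algebra_simps)
  also have "\<dots> \<le> (1 - a) * f xb + a * f z + a * (df xh \<bullet> (xp - z)) + a / 2 * p * (norm (xp - x))\<^sup>2"
    using a p convex_on_gderiv_le[OF f(1) f(2)]
    by (intro add_mono mult_left_mono mult_right_mono) auto
  finally have f_le: "f xbp \<le> (1 - a) * f xb + a * f z + a * (df xh \<bullet> (xp - z))
      + a / 2 * p * (norm (xp - x))\<^sup>2" .

  have Az: "A *v (xp - z) = ?r"
    using z by (simp add: matrix_vector_mult_diff_distrib)
  have "(df xh - transpose A *v l) \<bullet> (xp - z) = df xh \<bullet> (xp - z) - l \<bullet> ?r"
    by (simp add: inner_diff_left dot_lmul_matrix Az)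
  moreover have "G xp + (df xh - transpose A *v l) \<bullet> (xp - z) + \<beta> * (?r \<bullet> (A *v (xp - z)))
      + p * ((xp - x) \<bullet> (xp - z)) \<le> G z"
    by (rule composite_minimizer_variational_inequality[OF G xp z(1) min])
  ultimately have opt: "G xp + df xh \<bullet> (xp - z) \<le> G z + l \<bullet> ?r - \<beta> * (norm ?r)\<^sup>2
      - p / 2 * (2 * ((xp - x) \<bullet> (xp - z)))"
    unfolding Az by (simp add: power2_norm_eq_inner)

  have "(l - v) \<bullet> ?r - \<beta> * (norm ?r)\<^sup>2 \<le> ((norm (l - v))\<^sup>2 - (norm (lp - v))\<^sup>2) / (2 * c)"
    using dual_step_bound[OF lp c \<beta>, of v] c by (simp add: pos_le_divide_eq mult.commute)
  \<comment> \<open>The three-point identity supplies the term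
    \<open>p / 2 * (norm (xp - x))\<^sup>2\<close> that cancels the quadratic error in
    \<open>f_le\<close>.\<close>
  with opt have main: "G xp + df xh \<bullet> (xp - z) - G z - v \<bullet> ?r + p / 2 * (norm (xp - x))\<^sup>2
      \<le> ((norm (l - v))\<^sup>2 - (norm (lp - v))\<^sup>2) / (2 * c)
        + p / 2 * ((norm (x - z))\<^sup>2 - (norm (xp - z))\<^sup>2)" (is "?X \<le> ?Y")
    unfolding two_inner_eq_norm_sq by (simp add: inner_diff_left right_diff_distrib distrib_left)

  have res: "v \<bullet> (A *v xbp - b) = (1 - a) * (v \<bullet> (A *v xb - b)) + a * (v \<bullet> ?r)"
    by (simp add: xbp matrix_vector_right_distrib matrix_vector_mult_scaleR inner_simps algebra_simps)
  have "\<Phi> xbp z \<le> (1 - a) * \<Phi> xb z + a * ?X"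
    unfolding \<Phi>_def res using f_le G_le by (simp add: algebra_simps)
  also have "\<dots> \<le> (1 - a) * \<Phi> xb z + a * ?Y"
    using main a by (intro add_left_mono mult_left_mono) auto
  finally show "\<Phi> xbp z \<le> (1 - a) * \<Phi> xb z + a * ?Y" .
qed

theorem theorem2p6:
  fixes f :: "real^'n \<Rightarrow> real" and df :: "real^'n \<Rightarrow> real^'n"
    and g F :: "real^'n \<Rightarrow> ereal"
    and A :: "real^'n^'m" and b :: "real^'m"
    and L\<^sub>f \<gamma> \<eta> :: real
    and \<alpha> \<beta> \<gamma>s :: "nat \<Rightarrow> real" and P :: "nat \<Rightarrow> real^'n^'n"
    and x xbar :: "nat \<Rightarrow> real^'n" and l :: "nat \<Rightarrow> real^'m"
    and xs :: "real^'n" and ls :: "real^'m" and t :: nat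
  assumes f_convex: "convex_on UNIV f"
    and f_gradient: "\<And>z. GDERIV f z :> df z"
    and df_lipschitz: "\<And>y z. norm (df y - df z) \<le> L\<^sub>f * norm (y - z)"
    and g: "proper_closed_convex g"
    and F: "F = (\<lambda>z. ereal (f z) + g z)"
    and alm: "accelerated_linearized_ALM df g A b \<alpha> \<beta> \<gamma>s P x xbar l"
    and \<alpha>: "\<And>k. k \<ge> 1 \<Longrightarrow> \<alpha> k = 2 / (real k + 1)"
    and \<gamma>s: "\<And>k. k \<ge> 1 \<Longrightarrow> \<gamma>s k = real k * \<gamma>"
    and \<beta>: "\<And>k. k \<ge> 1 \<Longrightarrow> \<beta> k \<ge> \<gamma>s k / 2"
    and P: "\<And>k. k \<ge> 1 \<Longrightarrow> P k = (\<eta> / real k) *\<^sub>R mat 1"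
    and \<gamma>: "\<gamma> > 0" and \<eta>: "\<eta> \<ge> 2 * L\<^sub>f"
    and kkt: "KKT_point F A b xs ls"
    and t: "t \<ge> 1"
  shows "\<bar>F (xbar (t + 1)) - F xs\<bar>
           \<le> ereal (1 / (real t * (real t + 1)) *
                (\<eta> * (norm (x 1 - xs))\<^sup>2 + 4 * (norm ls)\<^sup>2 / \<gamma>))
       \<and> (ls \<noteq> 0 \<longrightarrow>
           norm (A *v xbar (t + 1) - b)
             \<le> 1 / (real t * (real t + 1) * norm ls) *
                (\<eta> * (norm (x 1 - xs))\<^sup>2 + 4 * (norm ls)\<^sup>2 / \<gamma>))"
proof -

  \<comment> \<open>Reduction to real-valued functions\<close>
  define D where "D = {z. g z \<noteq> \<infinity>}"
  define G where "G = (\<lambda>z. real_of_ereal (g z))"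
  have G_convex: "convex_on D G"
    unfolding D_def G_def by (rule proper_closed_convex_convex_on[OF g])
  have g_eq: "g z = ereal (G z)" if "z \<in> D" for z
    using that proper_closed_convex_ereal_real[OF g] by (simp add: D_def G_def)
  have F_eq: "F z = ereal (f z + G z)" if "z \<in> D" for z
    using that by (simp add: F g_eq)
  \<comment> \<open>The Lipschitz bound between a unit vector and 0 forces the sign. Hence
    \<open>\<eta> \<ge> 0\<close>, which later allows the primal distance to be dropped.\<close>
  have L: "L\<^sub>f \<ge> 0"
  proof -
    obtain y :: "real^'n" where "norm y = 1"
      using vector_choose_size[of 1] by auto
    then show ?thesis
      using order_trans[OF norm_ge_zero df_lipschitz[of y 0]] by simp
  qed
  with \<eta> have \<eta>0: "\<eta> \<ge> 0" by simp

  obtain w where w: "w \<in> subdifferential F xs" "w = transpose A *v ls" and Axs: "A *v xs = b"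
    using kkt by (auto simp: KKT_point_def)
  have xs_D: "xs \<in> D"
    using w(1) by (auto simp: subdifferential_def F D_def)

  \<comment> \<open>The iterates as minimizers over \<open>D\<close>\<close>
  have init: "xbar 1 = x 1" "l 1 = 0"
    using alm by (auto simp: accelerated_linearized_ALM_def)
  define xh where "xh k = (1 - \<alpha> k) *\<^sub>R xbar k + \<alpha> k *\<^sub>R x k" for k
  have step: "is_arg_min (subproblem df g A b (\<beta> k) (P k) (xh k) (l k) (x k)) (\<lambda>_. True) (x (k + 1))"
    "xbar (k + 1) = (1 - \<alpha> k) *\<^sub>R xbar k + \<alpha> k *\<^sub>R x (k + 1)"
    "l (k + 1) = l k - \<gamma>s k *\<^sub>R (A *v x (k + 1) - b)" if "k \<ge> 1" for k
    using alm that by (auto simp: accelerated_linearized_ALM_def xh_def Let_def)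

  have obj: "subproblem df g A b (\<beta> k) (P k) (xh k) (l k) (x k) y =
      ereal ((df (xh k) - transpose A *v l k) \<bullet> y + G y + \<beta> k / 2 * (norm (A *v y - b))\<^sup>2
        + (\<eta> / real k) / 2 * (norm (y - x k))\<^sup>2)" if "k \<ge> 1" "y \<in> D" for k y
    using that by (simp add: subproblem_def P wnorm_sq_def g_eq scaleR_matrix_vector_assoc[symmetric]
        power2_norm_eq_inner)
  \<comment> \<open>Outside \<open>D\<close> the objective is infinite, while at \<open>xs\<close>
    it is finite.\<close>
  have x_D: "x (k + 1) \<in> D" if "k \<ge> 1" for k
  proof (rule ccontr)
    assume "x (k + 1) \<notin> D"
    then have "subproblem df g A b (\<beta> k) (P k) (xh k) (l k) (x k) (x (k + 1)) = \<infinity>"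
      by (simp add: subproblem_def D_def)
    then show False
      using step(1)[OF that] obj[OF that xs_D] by (auto simp: is_arg_min_def)
  qed
  have min: "(df (xh k) - transpose A *v l k) \<bullet> x (k + 1) + G (x (k + 1))
        + \<beta> k / 2 * (norm (A *v x (k + 1) - b))\<^sup>2 + (\<eta> / real k) / 2 * (norm (x (k + 1) - x k))\<^sup>2
      \<le> (df (xh k) - transpose A *v l k) \<bullet> y + G y + \<beta> k / 2 * (norm (A *v y - b))\<^sup>2
        + (\<eta> / real k) / 2 * (norm (y - x k))\<^sup>2" if "k \<ge> 1" "y \<in> D" for k y
  proof -
    have "\<not> subproblem df g A b (\<beta> k) (P k) (xh k) (l k) (x k) y
        < subproblem df g A b (\<beta> k) (P k) (xh k) (l k) (x k) (x (k + 1))"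
      using step(1)[OF that(1)] by (simp add: is_arg_min_def)
    then show ?thesis
      unfolding obj[OF that(1) x_D[OF that(1)]] obj[OF that] by simp
  qed

  \<comment> \<open>Progress of one iteration\<close>
  define \<Phi> where "\<Phi> v y = f y + G y - (f xs + G xs) - v \<bullet> (A *v y - b)" for v y
  have one_step: "xbar (k + 1) \<in> D \<and>
      \<Phi> v (xbar (k + 1)) \<le> (1 - \<alpha> k) * \<Phi> v (xbar k)
        + \<alpha> k * (((norm (l k - v))\<^sup>2 - (norm (l (k + 1) - v))\<^sup>2) / (2 * \<gamma>s k)
          + (\<eta> / real k) / 2 * ((norm (x k - xs))\<^sup>2 - (norm (x (k + 1) - xs))\<^sup>2))"
    if k: "k \<ge> 1" and D: "xbar k \<in> D \<or> k = 1" for k v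
  proof -
    \<comment> \<open>\<open>\<alpha> 1 = 1\<close> covers a starting point outside
      \<open>D\<close>.\<close>
    have a: "0 < \<alpha> k" "\<alpha> k \<le> 1" and D': "xbar k \<in> D \<or> \<alpha> k = 1"
      using k D by (auto simp: \<alpha>)
    have c: "\<gamma>s k > 0" using k \<gamma> by (simp add: \<gamma>s)
    have "2 * L\<^sub>f * real k \<le> \<eta> * (real k + 1)"
      using \<eta> \<eta>0 by (intro mult_mono) auto
    then have p: "L\<^sub>f * \<alpha> k \<le> \<eta> / real k"
      using k by (simp add: \<alpha> field_simps)
    show ?thesis
      unfolding \<Phi>_def
      using lagrangian_gap_step[OF f_convex f_gradient df_lipschitz G_convex xs_D Axs x_D[OF k] D'
          xh_def min[OF k] a c \<beta>[OF k] p step(2,3)[OF k]] by blast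
  qed

  \<comment> \<open>Membership does not involve the multiplier, so \<open>v = 0\<close> serves
    below.\<close>
  have xbar_D: "xbar (k + 1) \<in> D" if "k \<ge> 1" for k
    using that
  proof (induction k rule: dec_induct)
    case base
    show ?case using one_step[of 1 0] by simp
  next
    case (step k)
    then show ?case using one_step[of "k + 1" 0] by simp
  qed

  \<comment> \<open>Telescoping energy\<close>
  define E where "E v k = real k * (real k - 1) * \<Phi> v (xbar k) + \<eta> * (norm (x k - xs))\<^sup>2
    + (norm (l k - v))\<^sup>2 / \<gamma>" for v k
  have E_step: "E v (k + 1) \<le> E v k" if k: "k \<ge> 1" for v k
  proof -
    have D: "xbar k \<in> D \<or> k = 1"
      using k xbar_D[of "k - 1"] by (cases "k = 1") auto
    \<comment> \<open>Isolates three coefficients. The choices of \<open>\<gamma>s k\<close> and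
      \<open>P k\<close> make those of the distances independent of \<open>k\<close>, and
      \<open>1 - \<alpha> k = (k - 1) / (k + 1)\<close> turns the weight \<open>k * (k + 1)\<close>
      into \<open>k * (k - 1)\<close>.\<close>
    have regroup: "n * ((1 - a) * \<phi> + a * (u / (2 * c) + e / 2 * d))
        = (n * (1 - a)) * \<phi> + (n * a / (2 * c)) * u + (n * a * e / 2) * d"
      for n a \<phi> u c e d :: real
      by (simp add: distrib_left mult.assoc)
    note s = conjunct2[OF one_step[OF k D, of v]]
    let ?N = "real k * (real k + 1)" and ?u = "(norm (l k - v))\<^sup>2 - (norm (l (k + 1) - v))\<^sup>2"
      and ?d = "(norm (x k - xs))\<^sup>2 - (norm (x (k + 1) - xs))\<^sup>2"
    have "?N * \<Phi> v (xbar (k + 1)) \<le> ?N * ((1 - \<alpha> k) * \<Phi> v (xbar k)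
        + \<alpha> k * (?u / (2 * \<gamma>s k) + (\<eta> / real k) / 2 * ?d))"
      using s by (intro mult_left_mono) auto
    also have "\<dots> = (?N * (1 - \<alpha> k)) * \<Phi> v (xbar k) + (?N * \<alpha> k / (2 * \<gamma>s k)) * ?u
        + (?N * \<alpha> k * (\<eta> / real k) / 2) * ?d"
      by (rule regroup)
    also have "?N * \<alpha> k = 2 * real k"
      using k by (simp add: \<alpha> add_eq_0_iff)
    also have "?N * (1 - \<alpha> k) = real k * (real k - 1)"
      using k by (simp add: \<alpha> field_simps)
    also have "2 * real k / (2 * \<gamma>s k) = 1 / \<gamma>"
      using k by (simp add: \<gamma>s)
    also have "2 * real k * (\<eta> / real k) / 2 = \<eta>"
      using k by simp
    finally show ?thesis
      by (simp add: E_def algebra_simps diff_divide_distrib)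
  qed
  have E_bound: "E v (t + 1) \<le> \<eta> * (norm (x 1 - xs))\<^sup>2 + (norm v)\<^sup>2 / \<gamma>" for v
  proof -
    have "E v (t + 1) \<le> E v 1"
      using t
    proof (induction t rule: dec_induct)
      case base
      show ?case using E_step[of 1] by simp
    next
      case (step k)
      then show ?case using E_step[of "k + 1" v] by simp
    qed
    \<comment> \<open>The weight \<open>k * (k - 1)\<close> vanishes at \<open>k = 1\<close>,
      removing the possibly meaningless \<open>G (xbar 1)\<close>; \<open>l 1 = 0\<close> leaves
      \<open>norm v\<close>.\<close>
    also have "E v 1 = \<eta> * (norm (x 1 - xs))\<^sup>2 + (norm v)\<^sup>2 / \<gamma>"
      unfolding E_def init by simp
    finally show ?thesis .
  qed

  \<comment> \<open>From the energy to the two bounds\<close>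
  define N where "N = real t * (real t + 1)"
  define C where "C = \<eta> * (norm (x 1 - xs))\<^sup>2 + 4 * (norm ls)\<^sup>2 / \<gamma>"
  define r where "r = A *v xbar (t + 1) - b"
  define gap where "gap = f (xbar (t + 1)) + G (xbar (t + 1)) - (f xs + G xs)"
  have N: "N > 0" using t by (simp add: N_def)
  \<comment> \<open>Both distances in \<open>E\<close> are nonnegative and are dropped; the norm of
    \<open>v\<close> produces the constant 4 in \<open>C\<close>.\<close>
  have upper: "gap - v \<bullet> r \<le> C / N" if v: "norm v = 2 * norm ls" for v
  proof -
    have "E v (t + 1) = N * (gap - v \<bullet> r) + \<eta> * (norm (x (t + 1) - xs))\<^sup>2
        + (norm (l (t + 1) - v))\<^sup>2 / \<gamma>"
      by (simp add: E_def N_def \<Phi>_def gap_def r_def ac_simps)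
    moreover have "0 \<le> \<eta> * (norm (x (t + 1) - xs))\<^sup>2" "0 \<le> (norm (l (t + 1) - v))\<^sup>2 / \<gamma>"
      using \<eta>0 \<gamma> by simp_all
    ultimately have "N * (gap - v \<bullet> r) \<le> E v (t + 1)"
      by linarith
    also have "\<dots> \<le> C"
      using E_bound[of v] by (simp add: v C_def power_mult_distrib)
    finally show ?thesis using N by (simp add: pos_le_divide_eq mult.commute)
  qed
  \<comment> \<open>Subgradient inequality at \<open>xs\<close>, with \<open>transpose A\<close>
    moved across the inner product and \<open>A *v xs = b\<close>.\<close>
  have lower: "ls \<bullet> r \<le> gap"
  proof -
    have "F xs + ereal (w \<bullet> (xbar (t + 1) - xs)) \<le> F (xbar (t + 1))"
      using w(1) by (simp add: subdifferential_def)
    then have "f xs + G xs + w \<bullet> (xbar (t + 1) - xs) \<le> f (xbar (t + 1)) + G (xbar (t + 1))"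
      by (simp add: F_eq xs_D xbar_D[OF t, simplified])
    moreover have "w \<bullet> (xbar (t + 1) - xs) = ls \<bullet> r"
      by (simp add: w(2) r_def dot_lmul_matrix matrix_vector_mult_diff_distrib Axs)
    ultimately show ?thesis by (simp add: gap_def)
  qed
  note bounds = gap_and_residual_bounds[OF upper lower]
  have "\<bar>F (xbar (t + 1)) - F xs\<bar> = ereal \<bar>gap\<bar>"
    by (simp add: F_eq[OF xs_D] F_eq[OF xbar_D[OF t], simplified] gap_def)
  then have "\<bar>F (xbar (t + 1)) - F xs\<bar> \<le> ereal (1 / N * C)"
    using bounds(1) by simp
  moreover have "norm r \<le> 1 / (N * norm ls) * C" if "ls \<noteq> 0"
    using bounds(2) that N by (simp add: field_simps)
  ultimately show ?thesis by (simp add: N_def C_def r_def)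
qed

end
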